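(* Let $k\ge 2$ and $N$ be positive integers with $N\ge (2k^{9/2})^k$, and let $A\subseteq [N]=\{1,\dots,N\}$ be a $B_k^*$-set. Then $$|A|\le 16\,k^{3/2}N^{1/k}.$$
   Context: A set $A\subseteq\mathbb{Z}$ is called a $B_k^*$-set (weak $B_k$-set) if in every solution of $x_1+\dots+x_k=y_1+\dots+y_k$ with all $x_i,y_i\in A$, at least two of the $2k$ numbers $x_1,\dots,x_k,y_1,\dots,y_k$ are equal; that is, the equation has no solution in $A$ in which all $2k$ variables are pairwise distinct. *)

theory Defs
  imports Complex_Main
begin

(* The two sides of x_1 + ... + x_k = y_1 + ... + y_k are given as lists of
   length k, so that "not distinct (xs @ ys)" says that two of the 2k entries,
   at different positions (on the same side or not), have equal values. *)
definition weak_B_set :: "nat \<Rightarrow> int set \<Rightarrow> bool" where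
  "weak_B_set k A \<longleftrightarrow>
     (\<forall>xs ys. length xs = k \<and> length ys = k \<and> set xs \<subseteq> A \<and> set ys \<subseteq> A \<and>
        sum_list xs = sum_list ys \<longrightarrow> \<not> distinct (xs @ ys))"

end

theory Submission
  imports Defs
begin

text \<open>Translate \<open>A\<close> by \<open>k N\<close>, so that all signed relations \<open>\<plusminus> x\<^sub>1 \<plusminus> \<dots> \<plusminus> x\<^bsub>2k\<^esub> = 0\<close> are balanced, and
  work modulo some \<open>M \<le> 4 k\<^sup>2 N\<close> too large for wrap-around. Put \<open>c\<^sub>j(a) = 2 cos (2 \<pi> a j / M)\<close> and
  \<open>F\<^sub>j = (\<Sum>a\<in>A. c\<^sub>j(a))\<close>. That \<open>A\<close> is a weak \<open>B\<^sub>k\<close>-set says that the elementary symmetric polynomial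
  of degree \<open>2 k\<close> in the real numbers \<open>c\<^sub>j(a)\<close> has mean zero over \<open>j\<close>. Let \<open>n\<close> be the size of \<open>A\<close>. Times \<open>(2k)!\<close>, this
  polynomial is at least \<open>(F\<^sub>j / 2)\<^bsup>2k\<^esup>\<close> when \<open>F\<^sub>j\<^sup>2 \<ge> 36 k n\<close>, as one sees from the ratios of
  consecutive degrees, and at most \<open>(64 k n)\<^sup>k\<close> in absolute value otherwise. Hence
  \<open>(2 n)\<^bsup>2k\<^esup> = F\<^sub>0\<^bsup>2k\<^esup> \<le> (\<Sum>j. F\<^sub>j\<^bsup>2k\<^esup>) \<le> 2 M (256 k n)\<^sup>k\<close>, which is of the order
  \<open>n = O(k N\<^bsup>1/k\<^esup>)\<close> and gives the claim for \<open>k \<ge> 32\<close>. For smaller \<open>k\<close> the constant is too large, and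
  Ruzsa's union bound over pairs of equal entries in a tuple suffices:
  \<open>(\<Sum>j. F\<^sub>j\<^bsup>2k\<^esup>) \<le> 8 k\<^sup>2 n (\<Sum>j. F\<^sub>j\<^bsup>2k-2\<^esup>)\<close>.\<close>

section \<open>Sums over injective tuples\<close>

text \<open>The value is \<open>m!\<close> times the \<open>m\<close>-th elementary symmetric polynomial of the family \<open>c\<close> over \<open>A\<close>.\<close>

primrec inj_sum :: "('a \<Rightarrow> real) \<Rightarrow> nat \<Rightarrow> 'a set \<Rightarrow> real" where
  "inj_sum c 0 A = 1"
| "inj_sum c (Suc m) A = (\<Sum>a\<in>A. c a * inj_sum c m (A - {a}))"

text \<open>An injective tuple of length \<open>Suc m\<close> avoids \<open>b\<close> or has it in
  exactly one of its \<open>Suc m\<close> positions; hence the factor.\<close>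

lemma inj_sum_remove:
  assumes "finite A" "b \<in> A"
  shows "inj_sum c (Suc m) A = inj_sum c (Suc m) (A - {b}) + real (Suc m) * c b * inj_sum c m (A - {b})"
  using assms
proof (induction m arbitrary: A)
  case 0
  then show ?case by (simp add: sum.remove)
next
  case (Suc m)
  have *: "A - {a} - {b} = A - {b} - {a}" for a
    by blast
  have "inj_sum c (Suc (Suc m)) A
      = c b * inj_sum c (Suc m) (A - {b}) + (\<Sum>a\<in>A - {b}. c a * inj_sum c (Suc m) (A - {a}))"
    using Suc.prems by (subst inj_sum.simps(2)) (rule sum.remove)
  also have "(\<Sum>a\<in>A - {b}. c a * inj_sum c (Suc m) (A - {a}))
      = (\<Sum>a\<in>A - {b}. c a * inj_sum c (Suc m) (A - {b} - {a})
          + (real (Suc m) * c b) * (c a * inj_sum c m (A - {b} - {a})))"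
  proof (rule sum.cong[OF refl])
    fix a assume a: "a \<in> A - {b}"
    have "inj_sum c (Suc m) (A - {a})
        = inj_sum c (Suc m) (A - {a} - {b}) + real (Suc m) * c b * inj_sum c m (A - {a} - {b})"
      by (rule Suc.IH) (use Suc.prems a in auto)
    then show "c a * inj_sum c (Suc m) (A - {a}) = c a * inj_sum c (Suc m) (A - {b} - {a})
          + (real (Suc m) * c b) * (c a * inj_sum c m (A - {b} - {a}))"
      unfolding * by (simp only: distrib_left mult_ac)
  qed
  also have "\<dots> = inj_sum c (Suc (Suc m)) (A - {b}) + real (Suc m) * c b * inj_sum c (Suc m) (A - {b})"
    by (simp only: sum.distrib sum_distrib_left[symmetric] inj_sum.simps(2)[symmetric])
  finally show ?case
    by (simp add: algebra_simps del: inj_sum.simps)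
qed

text \<open>A relative of Newton's identities: \<open>inj_sum_remove\<close>, solved for the sum
  over \<open>A - {a}\<close>, is inserted into the definition.\<close>

lemma inj_sum_recurrence:
  assumes "finite A"
  shows "inj_sum c (Suc (Suc m)) A
    = sum c A * inj_sum c (Suc m) A - real (Suc m) * (\<Sum>a\<in>A. (c a)\<^sup>2 * inj_sum c m (A - {a}))"
proof -
  have "inj_sum c (Suc (Suc m)) A
      = (\<Sum>a\<in>A. c a * (inj_sum c (Suc m) A - real (Suc m) * c a * inj_sum c m (A - {a})))"
    unfolding inj_sum.simps(2)[of c "Suc m"]
    by (rule sum.cong[OF refl]) (use inj_sum_remove[OF assms, of _ c m] in auto)
  then show ?thesis
    by (simp add: right_diff_distrib sum_subtractf sum_distrib_right sum_distrib_left
        power2_eq_square mult_ac del: inj_sum.simps)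
qed

lemma inj_sum_uminus: "inj_sum (\<lambda>a. - c a) m A = (- 1) ^ m * inj_sum c m A"
  by (induction m arbitrary: A) (auto simp: sum_distrib_left algebra_simps sum_negf)

lemma abs_sum_square_mult_le:
  fixes c :: "'a \<Rightarrow> real"
  assumes "\<And>a. a \<in> A \<Longrightarrow> \<bar>c a\<bar> \<le> 2" and "\<And>a. a \<in> A \<Longrightarrow> \<bar>g a\<bar> \<le> K"
  shows "\<bar>\<Sum>a\<in>A. (c a)\<^sup>2 * g a\<bar> \<le> 4 * real (card A) * K"
proof -
  have "\<bar>(c a)\<^sup>2 * g a\<bar> \<le> 4 * K" if "a \<in> A" for a
  proof -
    have "(c a)\<^sup>2 \<le> 2\<^sup>2"
      using assms(1)[OF that] by (metis abs_le_square_iff abs_numeral)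
    then show ?thesis
      using assms(2)[OF that] by (auto simp: abs_mult intro!: mult_mono)
  qed
  then have "(\<Sum>a\<in>A. \<bar>(c a)\<^sup>2 * g a\<bar>) \<le> (\<Sum>a\<in>A. 4 * K)"
    by (rule sum_mono)
  also have "\<dots> = 4 * real (card A) * K"
    by simp
  finally show ?thesis
    by (rule order_trans[OF sum_abs])
qed

text \<open>The recurrence closes because \<open>7 * 8 + 8 = 64\<close>. The term
  \<open>2 * real m\<close> is slack for the induction: deleting an element moves the sum by at most
  2, while the degree drops by two.\<close>

lemma abs_inj_sum_le:
  fixes c :: "'a \<Rightarrow> real"
  assumes fin: "finite A" and c: "\<And>a. a \<in> A \<Longrightarrow> \<bar>c a\<bar> \<le> 2"
    and u: "u > 0" "u\<^sup>2 = real k * real (card A)"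
    and m: "m \<le> 2 * k" and B: "B \<subseteq> A" "\<bar>sum c B\<bar> + 2 * real m \<le> 7 * u"
  shows "\<bar>inj_sum c m B\<bar> \<le> (8 * u) ^ m"
  using m B
proof (induction m arbitrary: B rule: less_induct)
  case (less m)
  have finB: "finite B"
    using fin less.prems finite_subset by blast
  consider "m = 0" | "m = 1" | l where "m = Suc (Suc l)"
    by (cases m rule: nat.exhaust; metis One_nat_def nat.exhaust)
  then show ?case
  proof cases
    case 1
    then show ?thesis by simp
  next
    case 2
    then show ?thesis using less.prems u(1) by simp
  next
    case 3
    have IH1: "\<bar>inj_sum c (Suc l) B\<bar> \<le> (8 * u) ^ Suc l"
      by (rule less.IH) (use 3 less.prems in auto)
    have IH2: "\<bar>inj_sum c l (B - {a})\<bar> \<le> (8 * u) ^ l" if a: "a \<in> B" for a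
    proof (rule less.IH)
      have "sum c (B - {a}) = sum c B - c a"
        using finB a by (simp add: sum_diff1)
      moreover have "\<bar>c a\<bar> \<le> 2"
        using c a less.prems by blast
      ultimately show "\<bar>sum c (B - {a})\<bar> + 2 * real l \<le> 7 * u"
        using less.prems 3 by simp
    qed (use 3 less.prems in auto)
    have "\<bar>\<Sum>a\<in>B. (c a)\<^sup>2 * inj_sum c l (B - {a})\<bar> \<le> 4 * real (card B) * (8 * u) ^ l"
      by (rule abs_sum_square_mult_le) (use IH2 c less.prems in auto)
    also have "\<dots> \<le> 4 * real (card A) * (8 * u) ^ l"
      using u(1) card_mono[OF fin less.prems(2)] by (intro mult_mono) auto
    finally have "real (Suc l) * \<bar>\<Sum>a\<in>B. (c a)\<^sup>2 * inj_sum c l (B - {a})\<bar>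
        \<le> (2 * real k) * (4 * real (card A) * (8 * u) ^ l)"
      using less.prems 3 u(1) by (intro mult_mono) auto
    also have "\<dots> = 8 * u\<^sup>2 * (8 * u) ^ l"
      using u by simp
    finally have 1: "real (Suc l) * \<bar>\<Sum>a\<in>B. (c a)\<^sup>2 * inj_sum c l (B - {a})\<bar> \<le> 8 * u\<^sup>2 * (8 * u) ^ l" .
    have 2: "\<bar>sum c B\<bar> * \<bar>inj_sum c (Suc l) B\<bar> \<le> (7 * u) * (8 * u) ^ Suc l"
      using IH1 less.prems u(1) by (intro mult_mono) auto
    have "\<bar>inj_sum c m B\<bar> \<le> \<bar>sum c B\<bar> * \<bar>inj_sum c (Suc l) B\<bar>
        + real (Suc l) * \<bar>\<Sum>a\<in>B. (c a)\<^sup>2 * inj_sum c l (B - {a})\<bar>"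
      unfolding 3 inj_sum_recurrence[OF finB]
      by (rule order_trans[OF abs_triangle_ineq4]) (simp add: abs_mult del: inj_sum.simps)
    also have "\<dots> \<le> (7 * u) * (8 * u) ^ Suc l + 8 * u\<^sup>2 * (8 * u) ^ l"
      using 1 2 by linarith
    also have "\<dots> = (8 * u) ^ m"
      unfolding 3 by (simp add: power2_eq_square algebra_simps)
    finally show ?thesis .
  qed
qed

text \<open>Once the first power sum \<open>F\<close> is large compared with \<open>sqrt (k n)\<close>, the recurrence is dominated by
  its first term; removing one element perturbs the values only by a bounded factor.\<close>

lemma inj_sum_ratio:
  fixes c :: "'a \<Rightarrow> real"
  assumes fin: "finite A" and c: "\<And>a. a \<in> A \<Longrightarrow> \<bar>c a\<bar> \<le> 2"
    and F: "F = sum c A" "F > 0" "F\<^sup>2 \<ge> 36 * real k * real (card A)" "F \<ge> 72 * real k"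
    and m: "m < 2 * k"
  shows "inj_sum c m A > 0 \<and> (\<forall>a\<in>A. \<bar>inj_sum c m (A - {a})\<bar> \<le> 9/8 * inj_sum c m A)
    \<and> inj_sum c (Suc m) A \<ge> F / 2 * inj_sum c m A"
  using m
proof (induction m)
  case 0
  then show ?case using F by simp
next
  case (Suc m)
  let ?E = "\<lambda>m. inj_sum c m A"
  from Suc have pos: "?E m > 0" and rem: "\<And>a. a \<in> A \<Longrightarrow> \<bar>inj_sum c m (A - {a})\<bar> \<le> 9/8 * ?E m"
    and step: "?E (Suc m) \<ge> F / 2 * ?E m"
    by auto
  have E0: "?E m \<le> 2 / F * ?E (Suc m)"
    using step F(2) by (simp add: field_simps del: inj_sum.simps)
  have pos': "?E (Suc m) > 0"
    using step pos F(2) by (meson half_gt_zero less_le_trans mult_pos_pos)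
  have "\<bar>inj_sum c (Suc m) (A - {a})\<bar> \<le> 9/8 * ?E (Suc m)" if a: "a \<in> A" for a
  proof -
    \<comment> \<open>Since \<open>2 k * 2 * 9/8 = 72 k / 16 \<le> F / 16\<close>, the removal costs
      at most an eighth of \<open>?E (Suc m)\<close>, which restores the factor 9/8.\<close>
    have "\<bar>real (Suc m) * c a * inj_sum c m (A - {a})\<bar> \<le> (2 * real k) * 2 * (9/8 * ?E m)"
      unfolding abs_mult using rem[OF a] c[OF a] Suc.prems pos by (intro mult_mono) auto
    also have "\<dots> \<le> F / 16 * ?E m"
      using F(4) pos by simp
    also have "\<dots> \<le> 1/8 * ?E (Suc m)"
      using step by simp
    finally show ?thesis
      using inj_sum_remove[OF fin a, of c m] pos' by linarith
  qed
  moreover have "?E (Suc (Suc m)) \<ge> F / 2 * ?E (Suc m)"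
  proof -
    \<comment> \<open>The correction is at most \<open>9 k n * ?E m\<close> with
      \<open>n = card A\<close>; as \<open>36 / 4 = 9\<close>, it consumes at most half of the main
      term \<open>F * ?E (Suc m)\<close>.\<close>
    have "\<bar>\<Sum>a\<in>A. (c a)\<^sup>2 * inj_sum c m (A - {a})\<bar> \<le> 4 * real (card A) * (9/8 * ?E m)"
      by (rule abs_sum_square_mult_le) (use c rem in auto)
    then have "real (Suc m) * \<bar>\<Sum>a\<in>A. (c a)\<^sup>2 * inj_sum c m (A - {a})\<bar>
        \<le> (2 * real k) * (4 * real (card A) * (9/8 * ?E m))"
      using Suc.prems by (intro mult_mono) auto
    also have "\<dots> = (9 * real k * real (card A)) * ?E m"
      by simp
    also have "\<dots> \<le> (F\<^sup>2 / 4) * ?E m"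
      using F(3) pos by (intro mult_right_mono) auto
    also have "\<dots> = F / 2 * (F / 2 * ?E m)"
      by (simp add: power2_eq_square)
    also have "\<dots> \<le> F / 2 * ?E (Suc m)"
      using step F(2) by (intro mult_left_mono) auto
    finally have "real (Suc m) * (\<Sum>a\<in>A. (c a)\<^sup>2 * inj_sum c m (A - {a})) \<le> F / 2 * ?E (Suc m)"
      by (smt (verit) mult_left_mono of_nat_0_le_iff)
    then show ?thesis
      unfolding inj_sum_recurrence[OF fin] F(1)[symmetric] by linarith
  qed
  ultimately show ?case
    using pos' by blast
qed

text \<open>With \<open>u = sqrt (k n)\<close>, \<open>n = card A\<close>, the cases split at
  \<open>\<bar>sum c A\<bar> = 6 u\<close>; negative sums reduce to positive ones as the degree is
  even. The bound on \<open>n\<close> gives \<open>u \<ge> 12 k\<close>, so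
  \<open>6 u \<ge> 72 k\<close> and \<open>6 u + 4 k \<le> 7 u\<close>. In the middle range both
  quantities are at most \<open>(8 u) ^ (2 * k)\<close>, hence the factor 2.\<close>

lemma inj_sum_ge:
  fixes c :: "'a \<Rightarrow> real"
  assumes fin: "finite A" and c: "\<And>a. a \<in> A \<Longrightarrow> \<bar>c a\<bar> \<le> 2" and k: "k > 0"
    and n: "real (card A) \<ge> 144 * real k"
  shows "inj_sum c (2 * k) A \<ge> (sum c A / 2) ^ (2 * k) - 2 * (64 * real k * real (card A)) ^ k"
proof -
  define u where "u = sqrt (real k * real (card A))"
  have u2: "u\<^sup>2 = real k * real (card A)"
    by (simp add: u_def)
  have "12 * real k \<le> u"
    unfolding u_def using k n by (intro real_le_rsqrt) (simp add: power2_eq_square)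
  then have u: "u > 0" "12 * real k \<le> u"
    using k by auto
  have large: "inj_sum d (2 * k) A \<ge> (sum d A / 2) ^ (2 * k)"
    if d: "\<And>a. a \<in> A \<Longrightarrow> \<bar>d a\<bar> \<le> 2" and F: "sum d A \<ge> 6 * u" for d :: "'a \<Rightarrow> real"
  proof -
    have "(6 * u)\<^sup>2 \<le> (sum d A)\<^sup>2"
      using F u by (intro power_mono) auto
    then have step: "inj_sum d (Suc m) A \<ge> sum d A / 2 * inj_sum d m A" if "m < 2 * k" for m
      using inj_sum_ratio[OF fin d refl _ _ _ that] F u u2 by (auto simp: power_mult_distrib)
    have "m \<le> 2 * k \<Longrightarrow> inj_sum d m A \<ge> (sum d A / 2) ^ m" for m
    proof (induction m)
      case (Suc m)
      then have "(sum d A / 2) ^ Suc m \<le> sum d A / 2 * inj_sum d m A"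
        using F u by (auto intro!: mult_left_mono)
      also have "\<dots> \<le> inj_sum d (Suc m) A"
        using step[of m] Suc.prems by simp
      finally show ?case .
    qed simp
    then show ?thesis by simp
  qed
  have nonneg: "0 \<le> (64 * real k * real (card A)) ^ k"
    by simp
  consider "sum c A \<ge> 6 * u" | "sum c A \<le> - (6 * u)" | "\<bar>sum c A\<bar> \<le> 6 * u"
    by linarith
  then show ?thesis
  proof cases
    case 1
    then have "(sum c A / 2) ^ (2 * k) \<le> inj_sum c (2 * k) A"
      by (intro large) (use c in auto)
    then show ?thesis using nonneg by linarith
  next
    case 2
    then have "(sum (\<lambda>a. - c a) A / 2) ^ (2 * k) \<le> inj_sum (\<lambda>a. - c a) (2 * k) A"
      by (intro large) (use c in \<open>auto simp: sum_negf\<close>)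
    then have "(sum c A / 2) ^ (2 * k) \<le> inj_sum c (2 * k) A"
      by (simp add: sum_negf inj_sum_uminus)
    then show ?thesis using nonneg by linarith
  next
    case 3
    have eq: "(64 * real k * real (card A)) ^ k = (8 * u) ^ (2 * k)"
      unfolding power_mult using u2 by (simp add: power_mult_distrib mult.assoc)
    have "\<bar>inj_sum c (2 * k) A\<bar> \<le> (8 * u) ^ (2 * k)"
      by (rule abs_inj_sum_le[OF fin c u(1) u2]) (use 3 u in auto)
    moreover have "\<bar>sum c A / 2\<bar> ^ (2 * k) \<le> (8 * u) ^ (2 * k)"
      using 3 u by (intro power_mono) auto
    moreover have "\<bar>sum c A / 2\<bar> ^ (2 * k) = (sum c A / 2) ^ (2 * k)"
      by (rule power_even_abs) simp
    ultimately show ?thesis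
      unfolding eq by linarith
  qed
qed

section \<open>Averages over the group of residues\<close>

text \<open>This is \<open>z + 1/z\<close> for \<open>z = cis (2 * pi * a * j / M)\<close>: products
  expand over all choices of signs and yet stay real.\<close>

definition char_val :: "nat \<Rightarrow> nat \<Rightarrow> int \<Rightarrow> real" where
  "char_val M j a = 2 * cos (2 * pi * real_of_int a * real j / real M)"

lemma abs_char_val_le: "\<bar>char_val M j a\<bar> \<le> 2"
  by (simp add: char_val_def abs_mult)

lemma cos_sum_dvd:
  assumes "M > 0" "int M dvd s"
  shows "(\<Sum>j<M. cos (2 * pi * real_of_int s * real j / real M)) = real M"
proof -
  obtain q where q: "s = int M * q"
    using assms(2) by blast
  have "cos (2 * pi * real_of_int s * real j / real M) = 1" for j
  proof -
    have "2 * pi * real_of_int s * real j / real M = 2 * pi * real_of_int (q * int j)"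
      using assms(1) by (simp add: q)
    then show ?thesis
      using cos_int_2pin by metis
  qed
  then show ?thesis by simp
qed

lemma cos_sum_not_dvd:
  assumes "M > 0" "\<not> int M dvd s"
  shows "(\<Sum>j<M. cos (2 * pi * real_of_int s * real j / real M)) = 0"
proof -
  define z where "z = cis (2 * pi * real_of_int s / real M)"
  have pow: "z ^ j = cis (2 * pi * real_of_int s * real j / real M)" for j
    unfolding z_def Complex.DeMoivre by (simp add: mult_ac)
  have "z \<noteq> 1"
  proof
    assume "z = 1"
    then have "cos (2 * pi * real_of_int s / real M) = 1"
      by (simp add: z_def complex_eq_iff)
    then obtain i :: int where "2 * pi * real_of_int s / real M = real_of_int i * 2 * pi"
      using cos_one_2pi_int by blast
    then have "real_of_int s = real_of_int (i * int M)"
      using assms(1) by (simp add: field_simps)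
    then have "s = i * int M"
      by linarith
    then show False
      using assms(2) by simp
  qed
  moreover have "z ^ M = 1"
    using assms(1) by (simp add: pow complex_eq_iff cos_int_2pin sin_int_2pin)
  ultimately have "(\<Sum>j<M. z ^ j) = 0"
    by (simp add: sum_gp_strict)
  then have "Re (\<Sum>j<M. z ^ j) = 0"
    by simp
  then show ?thesis
    by (simp add: pow)
qed

text \<open>The product-to-sum formula for cosines absorbs the head of the list into the frequency
  \<open>s\<close>, once with each sign.\<close>

lemma cos_sum_prod_Cons:
  "(\<Sum>j<M. cos (2 * pi * real_of_int s * real j / real M) * prod_list (map (char_val M j) (a # xs)))
    = (\<Sum>j<M. cos (2 * pi * real_of_int (s + a) * real j / real M) * prod_list (map (char_val M j) xs))
    + (\<Sum>j<M. cos (2 * pi * real_of_int (s - a) * real j / real M) * prod_list (map (char_val M j) xs))"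
proof -
  have *: "cos (2 * pi * real_of_int s * real j / real M) * char_val M j a
      = cos (2 * pi * real_of_int (s + a) * real j / real M)
      + cos (2 * pi * real_of_int (s - a) * real j / real M)" for j
    by (simp add: char_val_def cos_add cos_diff add_divide_distrib diff_divide_distrib
        distrib_left left_diff_distrib right_diff_distrib distrib_right)
  show ?thesis
    by (simp add: sum.distrib[symmetric] mult.assoc[symmetric] * distrib_right)
qed

lemma cos_sum_prod_nonneg:
  assumes "M > 0"
  shows "(\<Sum>j<M. cos (2 * pi * real_of_int s * real j / real M) * prod_list (map (char_val M j) xs)) \<ge> 0"
proof (induction xs arbitrary: s)
  case Nil
  then show ?case
    using cos_sum_dvd[OF assms, of s] cos_sum_not_dvd[OF assms, of s] by (cases "int M dvd s") auto
next
  case (Cons a xs)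
  then show ?case
    unfolding cos_sum_prod_Cons by (intro add_nonneg_nonneg)
qed

text \<open>The sum counts the choices of signs for which \<open>s \<plusminus> x\<^sub>1 \<plusminus> \<dots> \<plusminus> x\<^sub>l\<close> is divisible by \<open>M\<close>.\<close>

lemma cos_sum_prod_eq_0:
  assumes "M > 0"
    and "\<And>ps qs. set (ps @ qs) = set xs \<Longrightarrow> length (ps @ qs) = length xs
      \<Longrightarrow> \<not> int M dvd (s + sum_list ps - sum_list qs)"
  shows "(\<Sum>j<M. cos (2 * pi * real_of_int s * real j / real M) * prod_list (map (char_val M j) xs)) = 0"
  using assms(2)
proof (induction xs arbitrary: s)
  case Nil
  then have "\<not> int M dvd s"
    using Nil[of "[]" "[]"] by simp
  then show ?case
    using cos_sum_not_dvd[OF assms(1), of s] by simp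
next
  case (Cons a xs)
  have "(\<Sum>j<M. cos (2 * pi * real_of_int (s + a) * real j / real M) * prod_list (map (char_val M j) xs)) = 0"
  proof (rule Cons.IH)
    fix ps qs assume "set (ps @ qs) = set xs" "length (ps @ qs) = length xs"
    then show "\<not> int M dvd (s + a + sum_list ps - sum_list qs)"
      using Cons.prems[of "a # ps" qs] by (simp add: add.assoc)
  qed
  moreover have "(\<Sum>j<M. cos (2 * pi * real_of_int (s - a) * real j / real M) * prod_list (map (char_val M j) xs)) = 0"
  proof (rule Cons.IH)
    fix ps qs assume "set (ps @ qs) = set xs" "length (ps @ qs) = length xs"
    then show "\<not> int M dvd (s - a + sum_list ps - sum_list qs)"
      using Cons.prems[of ps "a # qs"] by (simp add: algebra_simps)
  qed
  ultimately show ?case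
    unfolding cos_sum_prod_Cons by simp
qed

section \<open>Functions of positive type\<close>

text \<open>Testing against products instead of pointwise makes the property stable under
  multiplication by \<open>char_val M j a\<close>, which may be negative.\<close>

definition pos_type :: "nat \<Rightarrow> int set \<Rightarrow> (nat \<Rightarrow> real) \<Rightarrow> bool" where
  "pos_type M A g \<longleftrightarrow> (\<forall>xs. set xs \<subseteq> A \<longrightarrow> (\<Sum>j<M. g j * prod_list (map (char_val M j) xs)) \<ge> 0)"

lemma pos_type_sum_nonneg: "pos_type M A g \<Longrightarrow> (\<Sum>j<M. g j) \<ge> 0"
  unfolding pos_type_def by (drule spec[of _ "[]"]) simp

lemma pos_type_0: "pos_type M A (\<lambda>j. 0)"
  by (simp add: pos_type_def)

lemma pos_type_1: "M > 0 \<Longrightarrow> pos_type M A (\<lambda>j. 1)"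
  unfolding pos_type_def using cos_sum_prod_nonneg[of M 0] by simp

lemma pos_type_add: "pos_type M A g \<Longrightarrow> pos_type M A h \<Longrightarrow> pos_type M A (\<lambda>j. g j + h j)"
  unfolding pos_type_def by (auto simp: distrib_right sum.distrib intro: add_nonneg_nonneg)

lemma pos_type_sum:
  assumes "\<And>a. a \<in> B \<Longrightarrow> pos_type M A (g a)"
  shows "pos_type M A (\<lambda>j. \<Sum>a\<in>B. g a j)"
proof (cases "finite B")
  case True
  then show ?thesis
    using assms by (induction B rule: finite_induct) (auto intro: pos_type_0 pos_type_add)
qed (simp add: pos_type_0)

lemma pos_type_scale: "pos_type M A g \<Longrightarrow> r \<ge> 0 \<Longrightarrow> pos_type M A (\<lambda>j. r * g j)"
  unfolding pos_type_def by (simp add: mult.assoc sum_distrib_left[symmetric])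

lemma pos_type_char_val:
  assumes "pos_type M A g" "a \<in> A"
  shows "pos_type M A (\<lambda>j. char_val M j a * g j)"
  unfolding pos_type_def
proof (intro allI impI)
  fix xs assume "set xs \<subseteq> A"
  then have "(\<Sum>j<M. g j * prod_list (map (char_val M j) (a # xs))) \<ge> 0"
    using assms unfolding pos_type_def by (metis insert_subset list.simps(15))
  then show "(\<Sum>j<M. char_val M j a * g j * prod_list (map (char_val M j) xs)) \<ge> 0"
    by (simp add: mult_ac)
qed

lemma pos_type_mult_sum:
  assumes "pos_type M A g"
  shows "pos_type M A (\<lambda>j. sum (char_val M j) A * g j)"
  unfolding sum_distrib_right by (intro pos_type_sum pos_type_char_val assms)

lemma pos_type_power: "M > 0 \<Longrightarrow> pos_type M A (\<lambda>j. sum (char_val M j) A ^ m)"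
  by (induction m) (simp_all add: pos_type_1 pos_type_mult_sum)

text \<open>The difference collects the \<open>m\<close>-tuples over \<open>A\<close> that are not
  injective tuples in \<open>B\<close>; the induction splits by whether the first entry lies in
  \<open>B\<close>.\<close>

lemma pos_type_power_minus_inj_sum:
  assumes "M > 0" "finite A" "B \<subseteq> A"
  shows "pos_type M A (\<lambda>j. sum (char_val M j) A ^ m - inj_sum (char_val M j) m B)"
  using assms(3)
proof (induction m arbitrary: B)
  case 0
  then show ?case by (simp add: pos_type_0)
next
  case (Suc m)
  let ?F = "\<lambda>j. sum (char_val M j) A"
  have eq: "?F j ^ Suc m - inj_sum (char_val M j) (Suc m) B
      = (\<Sum>a\<in>A - B. char_val M j a * ?F j ^ m)
      + (\<Sum>a\<in>B. char_val M j a * (?F j ^ m - inj_sum (char_val M j) m (B - {a})))" for j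
    using sum.subset_diff[OF Suc.prems assms(2), of "char_val M j"]
    by (simp add: sum_distrib_right right_diff_distrib sum_subtractf algebra_simps)
  show ?case
    unfolding eq
  proof (intro pos_type_add pos_type_sum pos_type_char_val)
    fix a assume "a \<in> B"
    then show "pos_type M A (\<lambda>j. ?F j ^ m - inj_sum (char_val M j) m (B - {a}))"
      by (intro Suc.IH) (use Suc.prems in auto)
  qed (use Suc.prems assms(1) in \<open>auto intro: pos_type_power\<close>)
qed

text \<open>A union bound: every non-injective tuple has two equal entries.\<close>

lemma pos_type_inj_sum_defect:
  assumes "M > 0" "finite A"
  shows "pos_type M A (\<lambda>j. inj_sum (char_val M j) (Suc m) A
    + real (Suc m choose 2) * ((\<Sum>a\<in>A. (char_val M j a)\<^sup>2) * sum (char_val M j) A ^ (m - 1))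
    - sum (char_val M j) A ^ Suc m)"
proof (induction m)
  case 0
  have *: "Suc 0 choose 2 = 0"
    by (simp add: numeral_2_eq_2)
  show ?case unfolding * by (simp add: pos_type_0)
next
  case (Suc m)
  let ?F = "\<lambda>j. sum (char_val M j) A"
  let ?P = "\<lambda>j. (\<Sum>a\<in>A. (char_val M j a)\<^sup>2)"
  \<comment> \<open>Pairs among the old positions, plus the pairs that contain the new one.\<close>
  have split: "real (Suc (Suc m) choose 2) = real (Suc m choose 2) + real (Suc m)"
    by (simp add: numeral_2_eq_2)
  \<comment> \<open>At \<open>m = 0\<close> the truncated exponent \<open>m - 1\<close> spoils the
    power, but the binomial coefficient vanishes.\<close>
  have shift: "real (Suc m choose 2) * (P * x ^ m) = real (Suc m choose 2) * (P * (x * x ^ (m - 1)))"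
    for P x :: real
    by (cases m) (simp_all add: numeral_2_eq_2)
  \<comment> \<open>The recurrence turns the new defect into \<open>?F\<close> times the old one
    plus a term that counts tuples by an entry repeating the new one; both are of positive
    type.\<close>
  have eq: "inj_sum (char_val M j) (Suc (Suc m)) A
      + real (Suc (Suc m) choose 2) * (?P j * ?F j ^ (Suc m - 1)) - ?F j ^ Suc (Suc m)
    = ?F j * (inj_sum (char_val M j) (Suc m) A
        + real (Suc m choose 2) * (?P j * ?F j ^ (m - 1)) - ?F j ^ Suc m)
    + real (Suc m) * (\<Sum>a\<in>A. char_val M j a * (char_val M j a *
        (?F j ^ m - inj_sum (char_val M j) m (A - {a}))))" for j
  proof -
    have *: "(\<Sum>a\<in>A. char_val M j a * (char_val M j a * (x - inj_sum (char_val M j) m (A - {a}))))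
        = ?P j * x - (\<Sum>a\<in>A. (char_val M j a)\<^sup>2 * inj_sum (char_val M j) m (A - {a}))" for x
      by (simp add: power2_eq_square right_diff_distrib sum_subtractf sum_distrib_left sum_distrib_right mult_ac)
    show ?thesis
      unfolding * split inj_sum_recurrence[OF assms(2)] diff_Suc_1 distrib_right shift
      by (simp add: algebra_simps del: inj_sum.simps of_nat_Suc)
  qed
  show ?case
    unfolding eq
    by (intro pos_type_add pos_type_mult_sum pos_type_scale pos_type_sum pos_type_char_val Suc.IH
        pos_type_power_minus_inj_sum) (use assms in auto)
qed

section \<open>Bounds for the moment of order \<open>2 k\<close>\<close>

text \<open>Takes the place of Hoelder's inequality when comparing consecutive even moments. The
  induction step adds the nonnegative term \<open>(k + 1) x^k (x - y)^2\<close>.\<close>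

lemma weighted_AM_GM:
  fixes x y :: real
  assumes "x \<ge> 0" "y \<ge> 0"
  shows "real (Suc k) * (y * x ^ k) \<le> real k * x ^ Suc k + y ^ Suc k"
proof (induction k)
  case (Suc k)
  have "0 \<le> real (Suc k) * x ^ k * (x - y)\<^sup>2"
    using assms by simp
  moreover have "y * (real (Suc k) * (y * x ^ k)) \<le> y * (real k * x ^ Suc k + y ^ Suc k)"
    using Suc assms by (intro mult_left_mono)
  ultimately show ?case
    by (simp add: power2_eq_square algebra_simps)
qed simp

text \<open>Let \<open>S\<close> be the moment on the left and \<open>y = 8 k^2 n\<close>,
  \<open>n = card A\<close>. The union bound gives \<open>S \<le> y * S'\<close> with
  \<open>S'\<close> the moment of order \<open>2 k - 2\<close>; AM-GM with \<open>x = F_j^2\<close>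
  then gives \<open>k S \<le> (k - 1) S + M y^k\<close>.\<close>

lemma moment_le_union_bound:
  assumes M: "M > 0" and fin: "finite A" and k: "k > 0"
    and zero: "(\<Sum>j<M. inj_sum (char_val M j) (2 * k) A) = 0"
  shows "(\<Sum>j<M. sum (char_val M j) A ^ (2 * k)) \<le> real M * (8 * (real k)\<^sup>2 * real (card A)) ^ k"
proof -
  obtain l where l: "k = Suc l"
    using k by (cases k) auto
  let ?F = "\<lambda>j. sum (char_val M j) A"
  define y where "y = 8 * (real k)\<^sup>2 * real (card A)"
  define b where "b = real (2 * k choose 2)"
  have "b \<le> 2 * (real k)\<^sup>2"
  proof -
    have "2 * k choose 2 = k * (2 * k - 1)"
      by (simp add: choose_two)
    also have "\<dots> \<le> k * (2 * k)"
      by simp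
    finally have "b \<le> real (k * (2 * k))"
      unfolding b_def by (simp only: of_nat_le_iff)
    then show ?thesis
      by (simp add: power2_eq_square)
  qed
  have "(\<Sum>j<M. inj_sum (char_val M j) (2 * k) A
      + b * ((\<Sum>a\<in>A. (char_val M j a)\<^sup>2) * ?F j ^ (2 * l)) - ?F j ^ (2 * k)) \<ge> 0"
    using pos_type_sum_nonneg[OF pos_type_inj_sum_defect[OF M fin, of "Suc (2 * l)"]]
    by (simp add: l b_def del: inj_sum.simps)
  then have "(\<Sum>j<M. ?F j ^ (2 * k)) \<le> (\<Sum>j<M. b * ((\<Sum>a\<in>A. (char_val M j a)\<^sup>2) * ?F j ^ (2 * l)))"
    by (simp add: sum_subtractf sum.distrib zero del: inj_sum.simps)
  also have "\<dots> \<le> (\<Sum>j<M. y * ?F j ^ (2 * l))"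
  proof (rule sum_mono)
    fix j
    have "(\<Sum>a\<in>A. (char_val M j a)\<^sup>2) \<le> 4 * real (card A)"
      using abs_sum_square_mult_le[of A "char_val M j" "\<lambda>_. 1" 1] abs_char_val_le by simp
    then have "b * (\<Sum>a\<in>A. (char_val M j a)\<^sup>2) \<le> (2 * (real k)\<^sup>2) * (4 * real (card A))"
      using \<open>b \<le> 2 * (real k)\<^sup>2\<close> by (intro mult_mono) (auto intro: sum_nonneg)
    then have "b * (\<Sum>a\<in>A. (char_val M j a)\<^sup>2) \<le> y"
      by (simp add: y_def)
    then show "b * ((\<Sum>a\<in>A. (char_val M j a)\<^sup>2) * ?F j ^ (2 * l)) \<le> y * ?F j ^ (2 * l)"
      unfolding mult.assoc[symmetric] by (rule mult_right_mono) (simp add: power_mult)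
  qed
  finally have "real k * (\<Sum>j<M. ?F j ^ (2 * k)) \<le> real k * (\<Sum>j<M. y * ?F j ^ (2 * l))"
    by (intro mult_left_mono) auto
  also have "\<dots> = (\<Sum>j<M. real (Suc l) * (y * ((?F j)\<^sup>2) ^ l))"
    by (simp add: sum_distrib_left l power_mult)
  also have "\<dots> \<le> (\<Sum>j<M. real l * ((?F j)\<^sup>2) ^ Suc l + y ^ Suc l)"
    by (intro sum_mono weighted_AM_GM) (simp_all add: y_def)
  also have "\<dots> = real l * (\<Sum>j<M. ?F j ^ (2 * k)) + real M * y ^ k"
    unfolding l power_mult by (simp only: sum.distrib sum_distrib_left) simp
  finally show ?thesis
    unfolding y_def[symmetric] by (simp add: l algebra_simps)
qed

text \<open>Averaging \<open>inj_sum_ge\<close> over \<open>j\<close>; clearing the halves costs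
  \<open>4 ^ k\<close> and turns 64 into 256.\<close>

lemma moment_le_pointwise:
  assumes fin: "finite A" and k: "k > 0" and n: "real (card A) \<ge> 144 * real k"
    and zero: "(\<Sum>j<M. inj_sum (char_val M j) (2 * k) A) = 0"
  shows "(\<Sum>j<M. sum (char_val M j) A ^ (2 * k)) \<le> real M * (2 * (256 * real k * real (card A)) ^ k)"
proof -
  let ?y = "(64 * real k * real (card A)) ^ k"
  have "(\<Sum>j<M. (sum (char_val M j) A / 2) ^ (2 * k) - 2 * ?y)
      \<le> (\<Sum>j<M. inj_sum (char_val M j) (2 * k) A)"
    by (intro sum_mono inj_sum_ge[OF fin _ k n]) (rule abs_char_val_le)
  then have "(\<Sum>j<M. (sum (char_val M j) A / 2) ^ (2 * k)) \<le> real M * (2 * ?y)"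
    by (simp add: zero sum_subtractf)
  moreover have "(\<Sum>j<M. (sum (char_val M j) A / 2) ^ (2 * k))
      = (\<Sum>j<M. sum (char_val M j) A ^ (2 * k)) / 4 ^ k"
    by (subst sum_divide_distrib) (simp add: power_divide power_mult)
  ultimately have "(\<Sum>j<M. sum (char_val M j) A ^ (2 * k)) / 4 ^ k \<le> real M * (2 * ?y)"
    by argo
  then have "(\<Sum>j<M. sum (char_val M j) A ^ (2 * k)) \<le> real M * (2 * ?y) * 4 ^ k"
    by (subst (asm) pos_divide_le_eq) simp_all
  also have "\<dots> = real M * (2 * (4 ^ k * ?y))"
    by (simp only: mult_ac)
  also have "4 ^ k * ?y = (256 * real k * real (card A)) ^ k"
    unfolding power_mult_distrib[symmetric] by (simp add: mult.assoc)
  finally show ?thesis .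
qed

section \<open>Weak \<open>B\<^sub>k\<close>-sets\<close>

lemma weak_B_set_translate:
  assumes "weak_B_set k A"
  shows "weak_B_set k ((\<lambda>a. a + t) ` A)"
  unfolding weak_B_set_def
proof (intro allI impI)
  fix xs ys :: "int list"
  assume h: "length xs = k \<and> length ys = k \<and> set xs \<subseteq> (\<lambda>a. a + t) ` A
    \<and> set ys \<subseteq> (\<lambda>a. a + t) ` A \<and> sum_list xs = sum_list ys"
  let ?f = "map (\<lambda>x. x - t)"
  have s: "sum_list (?f zs) = sum_list zs - int (length zs) * t" for zs
    by (induction zs) (simp_all add: algebra_simps)
  have "\<not> distinct (?f xs @ ?f ys)"
    by (rule assms[unfolded weak_B_set_def, rule_format]) (use h in \<open>auto simp: s\<close>)
  then have "\<not> distinct (?f (xs @ ys))"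
    by simp
  then show "\<not> distinct (xs @ ys)"
    unfolding distinct_map by (simp add: inj_on_def)
qed

lemma sum_list_bounds:
  fixes xs :: "int list"
  assumes "set xs \<subseteq> {l..h}"
  shows "int (length xs) * l \<le> sum_list xs" "sum_list xs \<le> int (length xs) * h"
  using assms by (induction xs) (auto simp: algebra_simps)

text \<open>Elements of size about \<open>k N\<close> but spread only over \<open>N\<close> admit no unbalanced relation
  \<open>x\<^sub>1 + \<dots> + x\<^sub>p = y\<^sub>1 + \<dots> + y\<^sub>q\<close> with \<open>p + q = 2 k\<close>.\<close>

lemma balanced_of_sum_eq:
  fixes ps qs :: "int list"
  assumes "set ps \<subseteq> {k * N + 1..k * N + N}" "set qs \<subseteq> {k * N + 1..k * N + N}"
    and "int (length ps) + int (length qs) = 2 * k" "sum_list ps = sum_list qs" "N > 0" "k > 0"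
  shows "length ps \<le> length qs"
proof (rule ccontr)
  assume "\<not> length ps \<le> length qs"
  then have p: "int (length ps) \<ge> k + 1" and q: "int (length qs) \<le> k - 1"
    using assms(3) by linarith+
  have "(k + 1) * (k * N + 1) \<le> int (length ps) * (k * N + 1)"
    using p assms(5,6) by (intro mult_right_mono) auto
  also have "\<dots> \<le> int (length qs) * (k * N + N)"
    using sum_list_bounds[OF assms(1)] sum_list_bounds[OF assms(2)] assms(4) by linarith
  also have "\<dots> \<le> (k - 1) * (k * N + N)"
    using q assms(5,6) by (intro mult_right_mono) auto
  finally have "k * N + N + k + 1 \<le> 0"
    by (simp add: algebra_simps)
  moreover have "k * N > 0"
    using assms(5,6) by simp
  ultimately show False
    using assms(5,6) by linarith
qed

text \<open>A signed sum of \<open>2 k\<close> elements of \<open>A\<close> is smaller than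
  \<open>M\<close> in absolute value, so divisibility by \<open>M\<close> forces it to vanish. The
  relation is then balanced, and distinct entries contradict the weak \<open>B_k\<close>
  property.\<close>

lemma sum_inj_sum_eq_0:
  assumes k: "k > 0" and N: "N > 0" and A: "A \<subseteq> {int k * int N + 1..int k * int N + int N}"
    and B: "weak_B_set k A" and M: "M = 2 * k * (k * N + N) + 1"
  shows "(\<Sum>j<M. inj_sum (char_val M j) (2 * k) A) = 0"
proof -
  have base: "(\<Sum>j<M. prod_list (map (char_val M j) xs)) = 0"
    if xs: "distinct xs" "set xs \<subseteq> A" "length xs = 2 * k" for xs
  proof -
    have "\<not> int M dvd (0 + sum_list ps - sum_list qs)"
      if h: "set (ps @ qs) = set xs" "length (ps @ qs) = length xs" for ps qs
    proof
      assume dvd: "int M dvd (0 + sum_list ps - sum_list qs)"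
      have sub: "set ps \<subseteq> A" "set qs \<subseteq> A"
        using h(1) xs(2) by auto
      have len: "int (length ps) + int (length qs) = 2 * int k"
        using h(2) xs(3) by simp
      have "A \<subseteq> {0..int k * int N + int N}"
        by (rule subset_trans[OF A]) simp
      then have "set ps \<subseteq> {0..int k * int N + int N}" "set qs \<subseteq> {0..int k * int N + int N}"
        using sub by auto
      note bp = sum_list_bounds[OF this(1)] and bq = sum_list_bounds[OF this(2)]
      have "int (length ps) * (int k * int N + int N) + int (length qs) * (int k * int N + int N) < int M"
        using len by (simp add: M distrib_right[symmetric])
      moreover have "0 \<le> int (length ps) * (int k * int N + int N)"
        "0 \<le> int (length qs) * (int k * int N + int N)"
        by simp_all
      ultimately have "\<bar>sum_list ps - sum_list qs\<bar> < int M"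
        using bp bq by linarith
      then have eq: "sum_list ps = sum_list qs"
        using dvd dvd_imp_le_int[of "sum_list ps - sum_list qs" "int M"] by force
      have "length ps \<le> length qs"
        using balanced_of_sum_eq[OF sub[THEN subset_trans, OF A] len eq] k N by simp
      moreover have "length qs \<le> length ps"
        using balanced_of_sum_eq[OF sub(2,1)[THEN subset_trans, OF A] _ eq[symmetric]] len k N by simp
      ultimately have "length ps = length qs"
        by simp
      then have "length ps = k \<and> length qs = k"
        using len by simp
      \<comment> \<open>It has the same set and the same length as the distinct list
        \<open>xs\<close>.\<close>
      moreover have "distinct (ps @ qs)"
        using h xs(1) card_distinct[of "ps @ qs"] distinct_card[of xs] by simp
      ultimately show False
        using B sub eq unfolding weak_B_set_def by blast
    qed
    then show ?thesis
      using cos_sum_prod_eq_0[of M xs 0] by (simp add: M)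
  qed
  \<comment> \<open>The injective sum is unfolded one entry at a time, with \<open>xs\<close>
    holding the entries already chosen.\<close>
  have "(\<Sum>j<M. prod_list (map (char_val M j) xs) * inj_sum (char_val M j) m (A - set xs)) = 0"
    if "distinct xs" "set xs \<subseteq> A" "m + length xs = 2 * k" for m xs
    using that
  proof (induction m arbitrary: xs)
    case 0
    then show ?case using base by simp
  next
    case (Suc m)
    have *: "A - insert a (set xs) = A - set xs - {a}" for a
      by blast
    have "(\<Sum>j<M. prod_list (map (char_val M j) xs) * inj_sum (char_val M j) (Suc m) (A - set xs))
        = (\<Sum>a\<in>A - set xs. \<Sum>j<M. prod_list (map (char_val M j) (a # xs))
            * inj_sum (char_val M j) m (A - set (a # xs)))"
      by (subst sum.swap) (simp add: sum_distrib_left * mult_ac)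
    also have "\<dots> = 0"
    proof (rule sum.neutral, rule ballI)
      fix a assume "a \<in> A - set xs"
      then show "(\<Sum>j<M. prod_list (map (char_val M j) (a # xs))
          * inj_sum (char_val M j) m (A - set (a # xs))) = 0"
        using Suc.prems by (intro Suc.IH) auto
    qed
    finally show ?case .
  qed
  from this[of "[]" "2 * k"] show ?thesis by simp
qed

section \<open>Numerical inequalities and conclusion\<close>

text \<open>The induction rests on \<open>(9/8)^4 < 2\<close>. It absorbs the polynomial factor left
  over for large \<open>k\<close>.\<close>

lemma power_growth: "k \<ge> 32 \<Longrightarrow> 64 * k ^ 4 \<le> (2::nat) ^ k"
proof (induction k rule: dec_induct)
  case base
  then show ?case by simp
next
  case (step k)
  have "64 * Suc k ^ 4 \<le> 2 * (64 * k ^ 4)"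
  proof -
    have "8 * Suc k \<le> 9 * k"
      using step by simp
    then have "(8 * Suc k) ^ 4 \<le> (9 * k) ^ 4"
      by (rule power_mono) simp
    then show ?thesis
      unfolding power_mult_distrib by (simp del: power_Suc mult_Suc_right)
  qed
  then show ?case
    using step.IH by simp
qed

lemma small_exponent_bound:
  assumes "2 \<le> k" "k \<le> 32"
  shows "16 * k ^ (4 + k) \<le> (64::nat) ^ k"
proof -
  have "\<forall>k\<in>set [2..<33]. 16 * k ^ (4 + k) \<le> (64::nat) ^ k"
    by (simp add: upt_rec)
  moreover have "k \<in> set [2..<33]"
    unfolding set_upt using assms by simp
  ultimately show ?thesis
    by (rule bspec)
qed

theorem theorem1:
  fixes k N :: nat and A :: "int set"
  assumes "k \<ge> 2" and "N \<ge> 1"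
    and "real N \<ge> (2 * real k powr (9/2)) ^ k"
    and "A \<subseteq> {1..int N}"
    and "weak_B_set k A"
  shows "real (card A) \<le> 16 * real k powr (3/2) * real N powr (1 / real k)"
proof (rule ccontr)
  assume neg: "\<not> ?thesis"
  define n where "n = real (card A)"
  define A' where "A' = (\<lambda>a. a + int k * int N) ` A"
  define M where "M = 2 * k * (k * N + N) + 1"
  have k: "k > 0" and N: "N > 0"
    using assms by auto
  have fin: "finite A'"
    unfolding A'_def using assms(4) finite_subset by blast
  have card: "real (card A') = n"
    unfolding A'_def n_def by (simp add: card_image)
  have A': "A' \<subseteq> {int k * int N + 1..int k * int N + int N}"
    unfolding A'_def using assms(4) by auto
  have zero: "(\<Sum>j<M. inj_sum (char_val M j) (2 * k) A') = 0"
    by (rule sum_inj_sum_eq_0[OF k N A' _ M_def]) (simp add: A'_def weak_B_set_translate assms(5))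
  have M: "M > 0"
    by (simp add: M_def)
  have M_le: "real M \<le> 4 * (real k)\<^sup>2 * real N"
  proof -
    have "2 * k + 1 \<le> k * k * 2"
      using mult_le_mono1[OF assms(1), of k] assms(1) by linarith
    then have "(2 * k + 1) * N \<le> k * k * 2 * N"
      by (rule mult_le_mono1)
    then have "M \<le> 4 * (k * k) * N"
      unfolding M_def using N by (simp add: algebra_simps)
    then have "real M \<le> real (4 * (k * k) * N)"
      by (simp only: of_nat_le_iff)
    then show ?thesis
      by (simp add: power2_eq_square)
  qed
  have "char_val M 0 a = 2" for a
    by (simp add: char_val_def)
  then have "(2 * n) ^ (2 * k) = sum (char_val M 0) A' ^ (2 * k)"
    by (simp add: card mult.commute)
  \<comment> \<open>Only the term \<open>j = 0\<close> is kept; the others are even powers.\<close>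
  also have "\<dots> \<le> (\<Sum>j<M. sum (char_val M j) A' ^ (2 * k))"
    by (rule member_le_sum) (use M in \<open>auto simp: power_mult\<close>)
  also have "(2 * n) ^ (2 * k) = (4 * n) ^ k * n ^ k"
  proof -
    have "(2 * n)\<^sup>2 = 4 * n * n"
      by (simp add: power2_eq_square)
    then show ?thesis
      unfolding power_mult power_mult_distrib[symmetric] by (simp only:)
  qed
  finally have lower: "(4 * n) ^ k * n ^ k \<le> (\<Sum>j<M. sum (char_val M j) A' ^ (2 * k))" .

  have lt: "16 * real k powr (3/2) * real N powr (1 / real k) < n"
    using neg by (simp add: n_def)
  have "0 < 16 * real k powr (3/2) * real N powr (1 / real k)"
    using k N by simp
  then have n: "n > 0"
    using lt by linarith
  have P: "(real k powr (3/2)) ^ (2 * k) = real k ^ (3 * k)"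
  proof -
    have "(real k powr (3/2)) ^ (2 * k) = real k powr (real (3 * k))"
      using k by (subst powr_realpow[symmetric]) (simp_all add: powr_powr)
    then show ?thesis
      using k by (simp only: powr_realpow of_nat_0_less_iff)
  qed
  have Q: "(real N powr (1 / real k)) ^ (2 * k) = (real N)\<^sup>2"
  proof -
    have "(real N powr (1 / real k)) ^ (2 * k) = real N powr (real 2)"
      using k N by (subst powr_realpow[symmetric]) (simp_all add: powr_powr)
    then show ?thesis
      using N by (simp only: powr_realpow of_nat_0_less_iff)
  qed
  \<comment> \<open>The power \<open>2 k\<close> clears all fractional exponents at once, leaving
    \<open>k^(3k)\<close> and \<open>N^2\<close>.\<close>
  have "(16 * real k powr (3/2) * real N powr (1 / real k)) ^ (2 * k) < n ^ (2 * k)"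
    using lt k by (intro power_strict_mono) auto
  then have big: "256 ^ k * real k ^ (3 * k) * (real N)\<^sup>2 < (n ^ k)\<^sup>2"
    unfolding power_mult_distrib P Q power_even_eq[of n] by (simp add: power_mult)
  show False
  proof (cases "k \<le> 32")
    case True
    have "(4 * n) ^ k * n ^ k \<le> real M * (8 * (real k)\<^sup>2 * n) ^ k"
      using lower moment_le_union_bound[OF M fin k zero] by (simp add: card)
    also have "\<dots> = (4 * n) ^ k * (real M * (2 * (real k)\<^sup>2) ^ k)"
    proof -
      have "8 * (real k)\<^sup>2 * n = 4 * n * (2 * (real k)\<^sup>2)"
        by simp
      then show ?thesis
        unfolding mult.left_commute[of _ "real M"] power_mult_distrib[symmetric] by (simp only:)
    qed
    finally have "n ^ k \<le> real M * (2 * (real k)\<^sup>2) ^ k"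
      using n by simp
    also have "\<dots> \<le> 4 * (real k)\<^sup>2 * real N * (2 * (real k)\<^sup>2) ^ k"
      using M_le by (intro mult_right_mono) auto
    finally have "(n ^ k)\<^sup>2 \<le> (4 * (real k)\<^sup>2 * real N * (2 * (real k)\<^sup>2) ^ k)\<^sup>2"
      using n by (intro power_mono) auto
    also have "\<dots> = (4 * real k ^ 3) ^ k * (real N)\<^sup>2 * (16 * real k ^ (4 + k))"
    proof -
      have "(2::real) ^ k * 2 ^ k = 4 ^ k"
        unfolding power_mult_distrib[symmetric] by simp
      moreover have "(real k ^ 3) ^ k = (real k ^ k) ^ 3" "((real k)\<^sup>2) ^ k = (real k ^ k)\<^sup>2"
        unfolding power_mult[symmetric] by (simp_all add: mult.commute)
      ultimately show ?thesis
        unfolding power_mult_distrib power_add by (simp add: power2_eq_square power3_eq_cube power4_eq_xxxx)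
    qed
    \<comment> \<open>The target is \<open>(256 k^3)^k N^2\<close>, so the last factor may be as
      large as \<open>(256 / 4)^k\<close>.\<close>
    also have "\<dots> \<le> (4 * real k ^ 3) ^ k * (real N)\<^sup>2 * 64 ^ k"
    proof (intro mult_left_mono)
      have "real (16 * k ^ (4 + k)) \<le> real (64 ^ k)"
        using small_exponent_bound[OF assms(1) True] by (simp only: of_nat_le_iff)
      then show "16 * real k ^ (4 + k) \<le> 64 ^ k"
        by simp
    qed auto
    also have "\<dots> = 256 ^ k * real k ^ (3 * k) * (real N)\<^sup>2"
    proof -
      have "(4::real) ^ k * 64 ^ k = 256 ^ k"
        unfolding power_mult_distrib[symmetric] by simp
      then show ?thesis
        unfolding power_mult_distrib power_mult by simp
    qed
    finally show False
      using big by simp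
  next
    case False
    \<comment> \<open>The lower bound on \<open>N\<close> gives
      \<open>N^(1/k) \<ge> 2 k^(9/2) \<ge> 64\<close>, hence even
      \<open>n > 16 * 64 * k\<close>.\<close>
    have "144 * real k \<le> n"
    proof -
      have "real k powr 1 \<le> real k powr (9/2)" "real k powr 1 \<le> real k powr (3/2)"
        using False by (intro powr_mono; simp)+
      then have pw: "32 \<le> real k powr (9/2)" "real k \<le> real k powr (3/2)"
        using False by auto
      have "2 * real k powr (9/2) = ((2 * real k powr (9/2)) ^ k) powr (1 / real k)"
        using k by (subst powr_realpow[symmetric]) (simp_all add: powr_powr)
      also have "\<dots> \<le> real N powr (1 / real k)"
        using assms(3) by (intro powr_mono2) auto
      finally have "real k * 64 \<le> real k powr (3/2) * real N powr (1 / real k)"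
        using pw by (intro mult_mono) auto
      then show ?thesis
        using lt by linarith
    qed
    then have "(4 * n) ^ k * n ^ k \<le> real M * (2 * (256 * real k * n) ^ k)"
      using lower moment_le_pointwise[OF fin k _ zero] by (simp add: card)
    also have "\<dots> = (4 * n) ^ k * (real M * (2 * (64 * real k) ^ k))"
    proof -
      have "256 * real k * n = 4 * n * (64 * real k)"
        by simp
      then have "(256 * real k * n) ^ k = (4 * n) ^ k * (64 * real k) ^ k"
        unfolding power_mult_distrib[symmetric] by (simp only:)
      then show ?thesis
        by (simp only: mult_ac)
    qed
    finally have "n ^ k \<le> real M * (2 * (64 * real k) ^ k)"
      using n by simp
    also have "\<dots> \<le> 4 * (real k)\<^sup>2 * real N * (2 * (64 * real k) ^ k)"
      using M_le by (intro mult_right_mono) auto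
    finally have "(n ^ k)\<^sup>2 \<le> (4 * (real k)\<^sup>2 * real N * (2 * (64 * real k) ^ k))\<^sup>2"
      using n by (intro power_mono) auto
    also have "\<dots> = 64 * real k ^ 4 * (real N)\<^sup>2 * (4096 * (real k)\<^sup>2) ^ k"
    proof -
      have "(64::real) ^ k * 64 ^ k = 4096 ^ k"
        unfolding power_mult_distrib[symmetric] by simp
      moreover have "((real k)\<^sup>2) ^ k = (real k ^ k)\<^sup>2"
        unfolding power_mult[symmetric] by (simp add: mult.commute)
      ultimately show ?thesis
        unfolding power_mult_distrib by (simp add: power2_eq_square power4_eq_xxxx)
    qed
    \<comment> \<open>The target \<open>(256 k^3)^k\<close> exceeds \<open>(4096 k^2)^k\<close> by
      the factor \<open>(k / 16)^k\<close>, which is at least \<open>2^k\<close> here.\<close>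
    also have "\<dots> \<le> (real k / 16) ^ k * (real N)\<^sup>2 * (4096 * (real k)\<^sup>2) ^ k"
    proof (intro mult_right_mono)
      have "real (64 * k ^ 4) \<le> real (2 ^ k)"
        using power_growth[of k] False by (simp only: of_nat_le_iff)
      also have "\<dots> \<le> (real k / 16) ^ k"
        using False by (simp add: power_mono)
      finally show "64 * real k ^ 4 \<le> (real k / 16) ^ k"
        by simp
    qed auto
    also have "\<dots> = 256 ^ k * real k ^ (3 * k) * (real N)\<^sup>2"
    proof -
      have "real k / 16 * (4096 * (real k)\<^sup>2) = 256 * real k ^ 3"
        by (simp add: power2_eq_square power3_eq_cube)
      then have "(real k / 16) ^ k * (4096 * (real k)\<^sup>2) ^ k = 256 ^ k * real k ^ (3 * k)"
        unfolding power_mult power_mult_distrib[symmetric] by simp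
      then show ?thesis
        by simp
    qed
    finally show False
      using big by simp
  qed
qed

end
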